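(* Let $d\ge2$ be an integer, let $T=(t_1,t_2)\subset\mathbb R$ be an interval, and let $\Lambda=\{\lambda_n\}$ with $$\lambda_n=\frac{n}{\log^{d-1}(n+1)},\qquad n=1,2,\ldots.$$ Then there is a constant $M(d)$ depending only on $d$ such that for every function $f$ on $T^d$ $$HV(f,T^d)\le M(d)\,\Lambda^{\#}V(f,T^d).$$
   Context: Let $D=\{1,\ldots,d\}$. All intervals below have endpoints in $T$; quantities may equal $+\infty$. **Mixed difference.** For a function $g$ of $p$ variables and intervals $J^k=(a^k,b^k)$, $k=1,\ldots,p$: for $p=1$, $g(J^1):=g(b^1)-g(a^1)$, and inductively $g(J^1\times\cdots\times J^p):=g(J^1\times\cdots\times J^{p-1},b^p)-g(J^1\times\cdots\times J^{p-1},a^p)$. **Harmonic variation.** For nonempty $\alpha=\{j_1<\cdots<j_p\}\subset D$, let $\widetilde\alpha=D\setminus\alpha$ and let $x_{\widetilde\alpha}\in T^{d-p}$ denote fixed values of the variables $x_j$, $j\in\widetilde\alpha$. Let $f(I^1\times\cdots\times I^p,x_{\widetilde\alpha})$ be the mixed difference of $f$ as a function of $x_{j_1},\ldots,x_{j_p}$ with the other variables fixed at $x_{\widetilde\alpha}$. Put $$HV^{\alpha}(f,T^d):=\sup_{x_{\widetilde\alpha}\in T^{d-p}}\ \sup\ \sum_{i_1,\ldots,i_p}\frac{|f(I^1_{i_1}\times\cdots\times I^p_{i_p},x_{\widetilde\alpha})|}{i_1\cdots i_p},$$ where the inner supremum is over all choices, for each $k=1,\ldots,p$, of a collection $\{I^k_i\}_i$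 of nonoverlapping intervals in $T$, indexed in arbitrary order. Then $HV(f,T^d):=\sum_{\emptyset\ne\alpha\subset D}HV^{\alpha}(f,T^d)$. **$\Lambda^{\#}$-variation.** For $s\in D$, an interval $I=(a,b)$ and $y=(y_1,\ldots,y_{s-1},y_{s+1},\ldots,y_d)\in T^{d-1}$, put $f(I^s,y):=f(y_1,\ldots,y_{s-1},b,y_{s+1},\ldots,y_d)-f(y_1,\ldots,y_{s-1},a,y_{s+1},\ldots,y_d)$ with $I^s=I$. Define $$\Lambda^{\#}V_s(f,T^d):=\sup_{\{y^i\}\subset T^{d-1}}\ \sup_{\{I_i\}}\ \sum_i\frac{|f(I_i^s,y^i)|}{\lambda_i},\qquad \Lambda^{\#}V(f,T^d):=\sum_{s=1}^d\Lambda^{\#}V_s(f,T^d),$$ where $\{I_i\}$ runs over all collections of nonoverlapping intervals in $T$, indexed in arbitrary order, and each $I_i$ may be paired with its own $y^i\in T^{d-1}$. *)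

theory Defs
  imports "HOL-Analysis.Analysis"
begin

text \<open>
  For a set \<open>A\<close> of coordinates, a point of \<open>T\<^sup>A\<close> is an element of \<open>A \<rightarrow>\<^sub>E T\<close>; in particular \<open>T\<^sup>d\<close> is
  \<open>{1..d} \<rightarrow>\<^sub>E T\<close>. Fixing the coordinates outside \<open>\<alpha>\<close> means giving \<open>x \<in> {1..d} - \<alpha> \<rightarrow>\<^sub>E T\<close>; updating \<open>x\<close>
  at all coordinates in \<open>\<alpha>\<close> gives a point of \<open>T\<^sup>d\<close>. A function on \<open>T\<^sup>d\<close> is modelled by a total
  function on \<open>nat \<Rightarrow> real\<close> which is only ever evaluated on \<open>{1..d} \<rightarrow>\<^sub>E T\<close>.
  An interval \<open>(a, b)\<close> is represented by the pair of its endpoints.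
\<close>

text \<open>
  The head of the list is the outermost variable, so for \<open>\<alpha> = {j\<^sub>1 < \<dots> < j\<^sub>p}\<close> the list to use is
  \<open>[j\<^sub>p, \<dots>, j\<^sub>1]\<close>: the inductive step then takes the difference in the last variable.
\<close>

primrec mixed_diff ::
  "((nat \<Rightarrow> real) \<Rightarrow> real) \<Rightarrow> nat list \<Rightarrow> (nat \<Rightarrow> real \<times> real) \<Rightarrow> (nat \<Rightarrow> real) \<Rightarrow> real"
where
  "mixed_diff f [] J x = f x"
| "mixed_diff f (j # js) J x =
     mixed_diff f js J (x(j := snd (J j))) - mixed_diff f js J (x(j := fst (J j)))"

text \<open>Collections may be finite (\<open>N = enat n\<close>) or infinite (\<open>N = \<infinity>\<close>); indices start at 1.\<close>

definition index_set :: "enat \<Rightarrow> nat set" where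
  "index_set N = {i. 1 \<le> i \<and> enat i \<le> N}"

definition nonoverlapping :: "real set \<Rightarrow> enat \<Rightarrow> (nat \<Rightarrow> real \<times> real) \<Rightarrow> bool" where
  "nonoverlapping T N I \<longleftrightarrow>
     (\<forall>i\<in>index_set N. fst (I i) \<in> T \<and> snd (I i) \<in> T \<and> fst (I i) < snd (I i)) \<and>
     disjoint_family_on (\<lambda>i. {fst (I i)<..<snd (I i)}) (index_set N)"

definition HV_alpha ::
  "nat \<Rightarrow> nat set \<Rightarrow> ((nat \<Rightarrow> real) \<Rightarrow> real) \<Rightarrow> real set \<Rightarrow> ennreal"
where
  "HV_alpha d \<alpha> f T =
     (SUP x \<in> {1..d} - \<alpha> \<rightarrow>\<^sub>E T.
      SUP (N, I) \<in> {(N, I). \<forall>j\<in>\<alpha>. nonoverlapping T (N j) (I j)}.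
        \<Sum>\<^sub>\<infinity>i \<in> (\<Pi>\<^sub>E j\<in>\<alpha>. index_set (N j)).
          ennreal (\<bar>mixed_diff f (rev (sorted_list_of_set \<alpha>)) (\<lambda>j. I j (i j)) x\<bar>
                   / (\<Prod>j\<in>\<alpha>. real (i j))))"

definition HV :: "nat \<Rightarrow> ((nat \<Rightarrow> real) \<Rightarrow> real) \<Rightarrow> real set \<Rightarrow> ennreal" where
  "HV d f T = (\<Sum>\<alpha> \<in> Pow {1..d} - {{}}. HV_alpha d \<alpha> f T)"

definition Lambda_sharp_V_at ::
  "(nat \<Rightarrow> real) \<Rightarrow> nat \<Rightarrow> nat \<Rightarrow> ((nat \<Rightarrow> real) \<Rightarrow> real) \<Rightarrow> real set \<Rightarrow> ennreal"
where
  "Lambda_sharp_V_at \<Lambda> d s f T =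
     (SUP y \<in> UNIV \<rightarrow> ({1..d} - {s} \<rightarrow>\<^sub>E T).
      SUP (N, I) \<in> {(N, I). nonoverlapping T N I}.
        \<Sum>\<^sub>\<infinity>i \<in> index_set N.
          ennreal (\<bar>f ((y i)(s := snd (I i))) - f ((y i)(s := fst (I i)))\<bar> / \<Lambda> i))"

definition Lambda_sharp_V ::
  "(nat \<Rightarrow> real) \<Rightarrow> nat \<Rightarrow> ((nat \<Rightarrow> real) \<Rightarrow> real) \<Rightarrow> real set \<Rightarrow> ennreal"
where
  "Lambda_sharp_V \<Lambda> d f T = (\<Sum>s = 1..d. Lambda_sharp_V_at \<Lambda> d s f T)"

end

theory Submission imports Defs begin

text \<open>
  Split the multi-indices \<open>(i\<^sub>1, \<dots>, i\<^sub>p)\<close> according to the position \<open>s\<close> of a largest index \<open>n\<close>. The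
  mixed difference is at most \<open>2\<^sup>p\<^sup>-\<^sup>1\<close> times a one-dimensional difference over the \<open>n\<close>-th interval in
  direction \<open>s\<close>, taken at the worst vertex \<open>y\<^sup>n\<close> among the finitely many admissible ones. The other
  \<open>p - 1\<close> indices then contribute at most the \<open>(p - 1)\<close>-st power of the \<open>n\<close>-th harmonic number,
  which is \<open>O(ln\<^sup>d\<^sup>-\<^sup>1 (n + 1))\<close>; this is exactly the weight \<open>n / \<lambda>\<^sub>n\<close>.
\<close>

section \<open>Mixed differences bounded by vertex values and by one-dimensional differences\<close>

text \<open>Each differencing step replaces one value by two, and keeping the one with the larger
  \<bar>f\<bar> costs a factor 2. Iterating this selects a single vertex of the box.\<close>

lemma mixed_diff_le_vertex:
  "\<exists>y. (\<forall>j\<in>set js. y j \<in> {fst (J j), snd (J j)}) \<and> (\<forall>j. j \<notin> set js \<longrightarrow> y j = x j) \<and>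
       \<bar>mixed_diff f js J x\<bar> \<le> 2 ^ length js * \<bar>f y\<bar>"
proof (induction js arbitrary: x)
  case Nil
  then show ?case by auto
next
  case (Cons j js)
  obtain u where u: "\<forall>k\<in>set js. u k \<in> {fst (J k), snd (J k)}"
      "\<forall>k. k \<notin> set js \<longrightarrow> u k = (x(j := snd (J j))) k"
      "\<bar>mixed_diff f js J (x(j := snd (J j)))\<bar> \<le> 2 ^ length js * \<bar>f u\<bar>"
    using Cons.IH[of "x(j := snd (J j))"] by blast
  obtain v where v: "\<forall>k\<in>set js. v k \<in> {fst (J k), snd (J k)}"
      "\<forall>k. k \<notin> set js \<longrightarrow> v k = (x(j := fst (J j))) k"
      "\<bar>mixed_diff f js J (x(j := fst (J j)))\<bar> \<le> 2 ^ length js * \<bar>f v\<bar>"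
    using Cons.IH[of "x(j := fst (J j))"] by blast
  define y where "y = (if \<bar>f u\<bar> \<le> \<bar>f v\<bar> then v else u)"
  have "2 ^ length js * \<bar>f u\<bar> \<le> 2 ^ length js * \<bar>f y\<bar>" "2 ^ length js * \<bar>f v\<bar> \<le> 2 ^ length js * \<bar>f y\<bar>"
    by (auto simp: y_def)
  then have "\<bar>mixed_diff f (j # js) J x\<bar> \<le> 2 ^ length (j # js) * \<bar>f y\<bar>"
    using u(3) v(3) abs_triangle_ineq4[of "mixed_diff f js J (x(j := snd (J j)))"
        "mixed_diff f js J (x(j := fst (J j)))"]
    unfolding mixed_diff.simps length_Cons power_Suc by linarith
  moreover have "\<forall>k\<in>set (j # js). y k \<in> {fst (J k), snd (J k)}"
    using u v by (cases "j \<in> set js") (auto simp: y_def)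
  moreover have "\<forall>k. k \<notin> set (j # js) \<longrightarrow> y k = x k"
    using u v by (auto simp: y_def)
  ultimately show ?case by blast
qed

text \<open>Differences in distinct coordinates commute. This lets an outermost difference in
  direction \<open>s\<close> be absorbed into the function, so that the vertex bound applies to the
  difference itself.\<close>

lemma mixed_diff_of_difference:
  assumes "s \<notin> set js"
  shows "mixed_diff (\<lambda>y. f (y(s := b)) - f (y(s := a))) js J x =
           mixed_diff f js J (x(s := b)) - mixed_diff f js J (x(s := a))"
  using assms by (induction js arbitrary: x) (auto simp: fun_upd_twist)

text \<open>The selection of the larger value is run in every direction except \<open>s\<close>,
  whose difference is retained; hence one factor 2 fewer than in the vertex bound. The value of
  \<open>y\<close> at \<open>s\<close> is overwritten by the updates.\<close>

lemma mixed_diff_le_difference: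
  assumes "s \<in> set js" "distinct js"
  shows "\<exists>y. (\<forall>j\<in>set js - {s}. y j \<in> {fst (J j), snd (J j)}) \<and>
             (\<forall>j. j \<notin> set js - {s} \<longrightarrow> y j = x j) \<and>
             \<bar>mixed_diff f js J x\<bar> \<le>
               2 ^ (length js - 1) * \<bar>f (y(s := snd (J s))) - f (y(s := fst (J s)))\<bar>"
  using assms
proof (induction js arbitrary: x)
  case Nil
  then show ?case by auto
next
  case (Cons j js)
  show ?case
  proof (cases "j = s")
    case True
    then have "s \<notin> set js" using Cons.prems by auto
    then show ?thesis
      using mixed_diff_le_vertex[of js J x "\<lambda>y. f (y(s := snd (J s))) - f (y(s := fst (J s)))"] True
      by (simp add: mixed_diff_of_difference del: fun_upd_apply)
  next
    case False
    define g where "g y = f (y(s := snd (J s))) - f (y(s := fst (J s)))" for y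
    have js: "s \<in> set js" "distinct js" "j \<notin> set js" using Cons.prems False by auto
    \<comment> \<open>\<open>js\<close> contains \<open>s\<close> and so is nonempty; the truncated
      subtraction is genuine.\<close>
    then have len: "(2::real) ^ length js = 2 * 2 ^ (length js - 1)"
      by (cases js) auto
    obtain u where u: "\<forall>k\<in>set js - {s}. u k \<in> {fst (J k), snd (J k)}"
        "\<forall>k. k \<notin> set js - {s} \<longrightarrow> u k = (x(j := snd (J j))) k"
        "\<bar>mixed_diff f js J (x(j := snd (J j)))\<bar> \<le> 2 ^ (length js - 1) * \<bar>g u\<bar>"
      using Cons.IH[OF js(1,2), of "x(j := snd (J j))"] unfolding g_def by blast
    obtain v where v: "\<forall>k\<in>set js - {s}. v k \<in> {fst (J k), snd (J k)}"
        "\<forall>k. k \<notin> set js - {s} \<longrightarrow> v k = (x(j := fst (J j))) k"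
        "\<bar>mixed_diff f js J (x(j := fst (J j)))\<bar> \<le> 2 ^ (length js - 1) * \<bar>g v\<bar>"
      using Cons.IH[OF js(1,2), of "x(j := fst (J j))"] unfolding g_def by blast
    define y where "y = (if \<bar>g u\<bar> \<le> \<bar>g v\<bar> then v else u)"
    have "2 ^ (length js - 1) * \<bar>g u\<bar> \<le> 2 ^ (length js - 1) * \<bar>g y\<bar>"
      "2 ^ (length js - 1) * \<bar>g v\<bar> \<le> 2 ^ (length js - 1) * \<bar>g y\<bar>"
      by (auto simp: y_def)
    then have "\<bar>mixed_diff f (j # js) J x\<bar> \<le> 2 ^ (length (j # js) - 1) * \<bar>g y\<bar>"
      using u(3) v(3) abs_triangle_ineq4[of "mixed_diff f js J (x(j := snd (J j)))"
          "mixed_diff f js J (x(j := fst (J j)))"]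
      unfolding mixed_diff.simps length_Cons diff_Suc_1 len by linarith
    moreover have "\<forall>k\<in>set (j # js) - {s}. y k \<in> {fst (J k), snd (J k)}"
      using u v js(3) by (auto simp: y_def)
    moreover have "\<forall>k. k \<notin> set (j # js) - {s} \<longrightarrow> y k = x k"
      using u v False by (auto simp: y_def)
    ultimately show ?thesis unfolding g_def by blast
  qed
qed

section \<open>Sums over multi-indices grouped by their largest entry\<close>

text \<open>The terms are nonnegative, so \<open>F\<close> may be enlarged to the full box, over
  which the sum factors into harmonic sums.\<close>

lemma sum_prod_inverse_le_harm_power:
  fixes F :: "('a \<Rightarrow> nat) set"
  assumes "finite A" "F \<subseteq> A \<rightarrow>\<^sub>E {1..n}"
  shows "(\<Sum>i\<in>F. \<Prod>j\<in>A. inverse (real (i j))) \<le> harm n ^ card A"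
proof -
  have "(\<Sum>i\<in>F. \<Prod>j\<in>A. inverse (real (i j))) \<le> (\<Sum>i\<in>A \<rightarrow>\<^sub>E {1..n}. \<Prod>j\<in>A. inverse (real (i j)))"
    using assms by (intro sum_mono2 prod_nonneg) (auto intro: finite_PiE)
  also have "\<dots> = (\<Prod>j\<in>A. \<Sum>k\<in>{1..n}. inverse (real k))"
    using assms(1) by (subst prod_sum_PiE) auto
  also have "\<dots> = harm n ^ card A"
    by (simp add: harm_def)
  finally show ?thesis .
qed

text \<open>Once the largest entry \<open>i s = n\<close> is fixed, the numerator is bounded by
  \<open>D n\<close> alone and comes out of the sum; the remaining \<open>card A - 1\<close> entries
  lie in \<open>{1..n}\<close> and contribute a power of \<open>harm n\<close>.\<close>

lemma sum_max_index_le: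
  fixes F :: "('a \<Rightarrow> nat) set" and a :: "('a \<Rightarrow> nat) \<Rightarrow> real"
  assumes "finite A" "s \<in> A" "finite F" "F \<subseteq> A \<rightarrow>\<^sub>E UNIV"
    and pos: "\<And>i j. i \<in> F \<Longrightarrow> j \<in> A \<Longrightarrow> 1 \<le> i j"
    and max: "\<And>i j. i \<in> F \<Longrightarrow> j \<in> A \<Longrightarrow> i j \<le> i s"
    and le: "\<And>i. i \<in> F \<Longrightarrow> a i \<le> D (i s)"
    and nonneg: "\<And>n. 0 \<le> D n"
  shows "(\<Sum>i\<in>F. a i / (\<Prod>j\<in>A. real (i j))) \<le>
           (\<Sum>n\<in>(\<lambda>i. i s) ` F. harm n ^ (card A - 1) / real n * D n)"
proof -
  have "(\<Sum>i\<in>{i\<in>F. i s = n}. a i / (\<Prod>j\<in>A. real (i j))) \<le> harm n ^ (card A - 1) / real n * D n" for n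
  proof -
    let ?G = "{i\<in>F. i s = n}" and ?r = "\<lambda>i. restrict i (A - {s})"
    \<comment> \<open>With the entry at \<open>s\<close> fixed and the values outside
      \<open>A\<close> being \<open>undefined\<close>, a multi-index is determined by its entries on
      \<open>A - {s}\<close>.\<close>
    have inj: "inj_on ?r ?G"
    proof (rule inj_onI)
      fix i i' assume *: "i \<in> ?G" "i' \<in> ?G" "?r i = ?r i'"
      show "i = i'"
      proof
        fix j
        show "i j = i' j"
        proof (cases "j \<in> A - {s}")
          case True
          then show ?thesis using fun_cong[OF *(3), of j] by simp
        next
          case False
          have ext: "i \<in> A \<rightarrow>\<^sub>E UNIV" "i' \<in> A \<rightarrow>\<^sub>E UNIV" using *(1,2) assms(4) by blast+
          show ?thesis
          proof (cases "j = s")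
            case True
            then show ?thesis using *(1,2) by simp
          next
            case False
            with \<open>j \<notin> A - {s}\<close> have "j \<notin> A" by blast
            then show ?thesis using PiE_arb[OF ext(1)] PiE_arb[OF ext(2)] by simp
          qed
        qed
      qed
    qed
    have "(\<Sum>i\<in>?G. a i / (\<Prod>j\<in>A. real (i j))) \<le>
        (\<Sum>i\<in>?G. D n / real n * (\<Prod>j\<in>A - {s}. inverse (real (?r i j))))"
    proof (rule sum_mono)
      fix i assume "i \<in> ?G"
      then have i: "i \<in> F" "i s = n" by auto
      have "a i / (\<Prod>j\<in>A. real (i j)) \<le> D n / (\<Prod>j\<in>A. real (i j))"
        using le[OF i(1)] i(2) by (intro divide_right_mono) (simp_all add: prod_nonneg)
      also have "\<dots> = D n / (real n * (\<Prod>j\<in>A - {s}. real (i j)))"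
        by (simp only: prod.remove[OF assms(1,2)] i(2))
      also have "\<dots> = D n / real n * (\<Prod>j\<in>A - {s}. inverse (real (?r i j)))"
        by (simp add: prod_inversef[symmetric] o_def divide_inverse)
      finally show "a i / (\<Prod>j\<in>A. real (i j)) \<le> \<dots>" .
    qed
    also have "\<dots> = D n / real n * (\<Sum>i\<in>?r ` ?G. \<Prod>j\<in>A - {s}. inverse (real (i j)))"
      by (simp only: sum.reindex[OF inj] sum_distrib_left o_def)
    also have "\<dots> \<le> D n / real n * harm n ^ card (A - {s})"
    proof (intro mult_left_mono sum_prod_inverse_le_harm_power)
      show "?r ` ?G \<subseteq> A - {s} \<rightarrow>\<^sub>E {1..n}"
      proof
        fix g assume "g \<in> ?r ` ?G"
        then obtain i where i: "i \<in> F" "i s = n" "g = ?r i" by blast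
        have "i j \<in> {1..n}" if "j \<in> A" for j
          using pos[OF i(1) that] max[OF i(1) that] i(2) by simp
        then show "g \<in> A - {s} \<rightarrow>\<^sub>E {1..n}" by (simp add: i(3))
      qed
    qed (use assms(1) nonneg in auto)
    also have "\<dots> = harm n ^ (card A - 1) / real n * D n"
      using assms(1,2) by simp
    finally show ?thesis .
  qed
  then show ?thesis
    by (subst sum.image_gen[OF assms(3), of _ "\<lambda>i. i s"]) (intro sum_mono)
qed

text \<open>For n \<ge> 1 the additive 1 in harm n \<le> ln n + 1 is absorbed through 1 \<le> ln (n
  + 1) / ln 2. The resulting base is at least 1, so the exponent can be raised to \<open>m\<close>;
  thus one weight serves index sets of every size.\<close>

lemma harm_power_le_ln_power:
  assumes "1 \<le> n" "k \<le> m"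
  shows "harm n ^ k \<le> (1 + 1 / ln 2) ^ m * ln (real n + 1) ^ m"
proof -
  have "ln 2 \<le> ln (real n + 1)" using assms by simp
  then have "1 \<le> 1 / ln 2 * ln (real n + 1)" by (simp add: field_simps)
  \<comment> \<open>The sequence harm n - ln n is decreasing and starts at 1.\<close>
  moreover have "harm n \<le> ln (real n) + 1"
    using euler_mascheroni_sequence_decreasing[of 1 n] assms(1) by (simp add: harm_expand)
  moreover have "ln (real n) \<le> ln (real n + 1)" "0 \<le> ln (real n)" using assms by auto
  ultimately have "harm n \<le> (1 + 1 / ln 2) * ln (real n + 1)" "1 \<le> (1 + 1 / ln 2) * ln (real n + 1)"
    unfolding distrib_right by linarith+
  then have "harm n ^ k \<le> ((1 + 1 / ln 2) * ln (real n + 1)) ^ k"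
    "((1 + 1 / ln 2) * ln (real n + 1)) ^ k \<le> ((1 + 1 / ln 2) * ln (real n + 1)) ^ m"
    using assms(2) by (auto intro!: power_mono power_increasing harm_nonneg)
  then show ?thesis by (simp add: power_mult_distrib)
qed

section \<open>Passage between infinite sums in \<open>ennreal\<close> and finite real sums\<close>

lemma infsum_ennreal_leI:
  fixes g :: "'a \<Rightarrow> ennreal"
  assumes "\<And>F. finite F \<Longrightarrow> F \<subseteq> A \<Longrightarrow> sum g F \<le> B"
  shows "infsum g A \<le> B"
  by (subst nonneg_infsum_complete) (auto intro!: SUP_least assms)

lemma sum_le_infsum_ennreal:
  fixes g :: "'a \<Rightarrow> ennreal"
  assumes "finite F" "F \<subseteq> A"
  shows "sum g F \<le> infsum g A"
  by (subst nonneg_infsum_complete) (use assms in \<open>auto intro!: SUP_upper\<close>)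

text \<open>A finite part of the sum for one admissible choice of intervals and base points lies
  below the supremum. Stating it with a real sum lets all estimates be made in the reals.\<close>

lemma sum_le_Lambda_sharp_V_at:
  assumes "nonoverlapping T N I" "finite G" "G \<subseteq> index_set N"
    and "\<And>n. y n \<in> {1..d} - {s} \<rightarrow>\<^sub>E T"
    and "\<And>n. n \<in> G \<Longrightarrow> 0 \<le> \<Lambda> n"
  shows "ennreal (\<Sum>n\<in>G. \<bar>f ((y n)(s := snd (I n))) - f ((y n)(s := fst (I n)))\<bar> / \<Lambda> n)
           \<le> Lambda_sharp_V_at \<Lambda> d s f T"
proof -
  let ?g = "\<lambda>n. \<bar>f ((y n)(s := snd (I n))) - f ((y n)(s := fst (I n)))\<bar> / \<Lambda> n"
  have "ennreal (sum ?g G) = (\<Sum>n\<in>G. ennreal (?g n))"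
    using assms(5) by (intro sum_ennreal[symmetric]) auto
  also have "\<dots> \<le> (\<Sum>\<^sub>\<infinity>n\<in>index_set N. ennreal (?g n))"
    using assms(2,3) by (rule sum_le_infsum_ennreal)
  also have "\<dots> \<le> Lambda_sharp_V_at \<Lambda> d s f T"
    unfolding Lambda_sharp_V_at_def
    by (rule SUP_upper2[of y], use assms(4) in blast, rule SUP_upper2[of "(N, I)"])
      (use assms(1) in auto)
  finally show ?thesis .
qed

lemma index_set_pos: "i \<in> index_set N \<Longrightarrow> 1 \<le> i"
  by (simp add: index_set_def)

section \<open>Multi-indices whose largest entry sits in a fixed direction\<close>

text \<open>Many multi-indices share the same largest entry n, while the variation pairs the n-th
  interval with only one base point. As \<open>F\<close> is finite, a worst base point exists for
  each n and dominates all of them.\<close>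

lemma sum_max_index_le_Lambda_sharp_V_at:
  fixes f :: "(nat \<Rightarrow> real) \<Rightarrow> real" and I :: "nat \<Rightarrow> nat \<Rightarrow> real \<times> real"
  assumes \<alpha>: "\<alpha> \<subseteq> {1..d}" "s \<in> \<alpha>" and x: "x \<in> {1..d} - \<alpha> \<rightarrow>\<^sub>E T"
    and I: "\<And>j. j \<in> \<alpha> \<Longrightarrow> nonoverlapping T (N j) (I j)"
    and F: "finite F" "F \<subseteq> (\<Pi>\<^sub>E j\<in>\<alpha>. index_set (N j))"
    and max: "\<And>i j. i \<in> F \<Longrightarrow> j \<in> \<alpha> \<Longrightarrow> i j \<le> i s"
    and "T \<noteq> {}"
  shows "ennreal (\<Sum>i\<in>F. \<bar>mixed_diff f (rev (sorted_list_of_set \<alpha>)) (\<lambda>j. I j (i j)) x\<bar>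
                            / (\<Prod>j\<in>\<alpha>. real (i j)))
    \<le> ennreal (2 ^ (d - 1) * (1 + 1 / ln 2) ^ (d - 1)) *
      Lambda_sharp_V_at (\<lambda>n. real n / ln (real n + 1) ^ (d - 1)) d s f T"
proof -
  define \<Delta> where "\<Delta> y n = \<bar>f (y(s := snd (I s n))) - f (y(s := fst (I s n)))\<bar>" for y n
  let ?md = "\<lambda>i. mixed_diff f (rev (sorted_list_of_set \<alpha>)) (\<lambda>j. I j (i j)) x"
  let ?Y = "{1..d} - {s} \<rightarrow>\<^sub>E T"
  have fin: "finite \<alpha>" using \<alpha>(1) finite_subset by blast
  have card: "card \<alpha> - 1 \<le> d - 1" using card_mono[OF _ \<alpha>(1)] by simp
  have "\<forall>i\<in>F. \<exists>y. y \<in> ?Y \<and> \<bar>?md i\<bar> \<le> 2 ^ (card \<alpha> - 1) * \<Delta> y (i s)"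
  proof
    fix i assume "i \<in> F"
    let ?J = "\<lambda>j. I j (i j)"
    have set: "set (rev (sorted_list_of_set \<alpha>)) = \<alpha>" using fin by simp
    obtain y where y: "\<forall>j\<in>\<alpha> - {s}. y j \<in> {fst (?J j), snd (?J j)}"
        "\<forall>j. j \<notin> \<alpha> - {s} \<longrightarrow> y j = x j" "\<bar>?md i\<bar> \<le> 2 ^ (card \<alpha> - 1) * \<Delta> y (i s)"
      using mixed_diff_le_difference[of s "rev (sorted_list_of_set \<alpha>)" ?J x f] \<alpha>(2)
      unfolding set \<Delta>_def by auto
    have "fst (?J j) \<in> T \<and> snd (?J j) \<in> T" if "j \<in> \<alpha>" for j
      using I[OF that] F(2) \<open>i \<in> F\<close> that unfolding nonoverlapping_def by blast
    then have yT: "y j \<in> T" if "j \<in> \<alpha> - {s}" for j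
      using y(1) that by force
    have "y \<in> ?Y"
    proof (rule PiE_I)
      fix j assume "j \<in> {1..d} - {s}"
      then show "y j \<in> T" using yT[of j] y(2) PiE_mem[OF x, of j] by (cases "j \<in> \<alpha>") auto
    next
      \<comment> \<open>At \<open>s\<close> itself \<open>y\<close> keeps the value of
        \<open>x\<close>, which is \<open>undefined\<close> because \<open>s\<close> lies in
        \<alpha>; so \<open>y\<close> is extensional on the right set.\<close>
      fix j assume "j \<notin> {1..d} - {s}"
      then have "j \<notin> \<alpha> - {s}" "j \<notin> {1..d} - \<alpha>" using \<alpha> by blast+
      then show "y j = undefined" using y(2) PiE_arb[OF x] by simp
    qed
    with y(3) show "\<exists>y. y \<in> ?Y \<and> \<bar>?md i\<bar> \<le> 2 ^ (card \<alpha> - 1) * \<Delta> y (i s)" by blast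
  qed
  from bchoice[OF this] obtain w
    where "\<forall>i\<in>F. w i \<in> ?Y \<and> \<bar>?md i\<bar> \<le> 2 ^ (card \<alpha> - 1) * \<Delta> (w i) (i s)" ..
  then have w: "w i \<in> ?Y" "\<bar>?md i\<bar> \<le> 2 ^ (card \<alpha> - 1) * \<Delta> (w i) (i s)" if "i \<in> F" for i
    using that by simp_all
  have "\<exists>y. y \<in> ?Y \<and> (\<forall>i\<in>F. i s = n \<longrightarrow> \<Delta> (w i) n \<le> \<Delta> y n)" for n
  proof (cases "{i\<in>F. i s = n} = {}")
    \<comment> \<open>No multi-index has \<open>n\<close> at position \<open>s\<close>, so any point
      of the nonempty set \<open>?Y\<close> will do.\<close>
    case True
    have "?Y \<noteq> {}" using \<open>T \<noteq> {}\<close> by (auto simp: PiE_eq_empty_iff)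
    then show ?thesis using True by blast
  next
    case False
    let ?S = "(\<lambda>i. \<Delta> (w i) n) ` {i\<in>F. i s = n}"
    have "Max ?S \<in> ?S" using False F(1) by (intro Max_in) auto
    then obtain i where i: "i \<in> F" "i s = n" "Max ?S = \<Delta> (w i) n" by blast
    have "\<Delta> (w i') n \<le> Max ?S" if "i' \<in> F" "i' s = n" for i'
      using that F(1) by (intro Max_ge) auto
    then show ?thesis using i(3) w(1)[OF i(1)] by auto
  qed
  then have "\<forall>n. \<exists>y. y \<in> ?Y \<and> (\<forall>i\<in>F. i s = n \<longrightarrow> \<Delta> (w i) n \<le> \<Delta> y n)" by blast
  from choice[OF this] obtain y
    where "\<forall>n. y n \<in> ?Y \<and> (\<forall>i\<in>F. i s = n \<longrightarrow> \<Delta> (w i) n \<le> \<Delta> (y n) n)" ..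
  then have y: "y n \<in> ?Y" "i \<in> F \<Longrightarrow> \<Delta> (w i) (i s) \<le> \<Delta> (y (i s)) (i s)" for n i
    by simp_all
  let ?G = "(\<lambda>i. i s) ` F"
  have G: "?G \<subseteq> index_set (N s)" using F(2) \<alpha>(2) by auto
  have "(\<Sum>i\<in>F. \<bar>?md i\<bar> / (\<Prod>j\<in>\<alpha>. real (i j))) \<le>
      (\<Sum>n\<in>?G. harm n ^ (card \<alpha> - 1) / real n * (2 ^ (card \<alpha> - 1) * \<Delta> (y n) n))"
  proof (rule sum_max_index_le)
    show "F \<subseteq> \<alpha> \<rightarrow>\<^sub>E UNIV" using F(2) by (auto simp: PiE_iff)
    show "1 \<le> i j" if "i \<in> F" "j \<in> \<alpha>" for i j
      using F(2) that by (intro index_set_pos[of _ "N j"]) auto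
    show "\<bar>?md i\<bar> \<le> 2 ^ (card \<alpha> - 1) * \<Delta> (y (i s)) (i s)" if "i \<in> F" for i
      using w(2)[OF that] y(2)[OF that] by (elim order_trans) simp
    show "0 \<le> 2 ^ (card \<alpha> - 1) * \<Delta> (y n) n" for n by (simp add: \<Delta>_def)
  qed (use fin \<alpha>(2) F(1) max in auto)
  also have "\<dots> \<le> (\<Sum>n\<in>?G. 2 ^ (d - 1) * (1 + 1 / ln 2) ^ (d - 1) *
      (\<Delta> (y n) n / (real n / ln (real n + 1) ^ (d - 1))))"
  proof (rule sum_mono)
    fix n assume "n \<in> ?G"
    then have n: "1 \<le> n" using G index_set_pos by blast
    have "harm n ^ (card \<alpha> - 1) / real n * (2 ^ (card \<alpha> - 1) * \<Delta> (y n) n) \<le>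
        (1 + 1 / ln 2) ^ (d - 1) * ln (real n + 1) ^ (d - 1) / real n * (2 ^ (d - 1) * \<Delta> (y n) n)"
      \<comment> \<open>Both exponents \<open>card \<alpha> - 1\<close> are raised to
        \<open>d - 1\<close>, which makes the constant independent of \<alpha>.\<close>
      using n card by (intro mult_mono divide_right_mono harm_power_le_ln_power power_increasing)
        (auto simp: \<Delta>_def)
    also have "\<dots> = 2 ^ (d - 1) * (1 + 1 / ln 2) ^ (d - 1) *
      (\<Delta> (y n) n / (real n / ln (real n + 1) ^ (d - 1)))"
      by (simp add: mult_ac)
    finally show "harm n ^ (card \<alpha> - 1) / real n * (2 ^ (card \<alpha> - 1) * \<Delta> (y n) n) \<le> \<dots>" .
  qed
  finally have "(\<Sum>i\<in>F. \<bar>?md i\<bar> / (\<Prod>j\<in>\<alpha>. real (i j))) \<le> 2 ^ (d - 1) * (1 + 1 / ln 2) ^ (d - 1) *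
      (\<Sum>n\<in>?G. \<Delta> (y n) n / (real n / ln (real n + 1) ^ (d - 1)))"
    by (simp only: sum_distrib_left)
  then have "ennreal (\<Sum>i\<in>F. \<bar>?md i\<bar> / (\<Prod>j\<in>\<alpha>. real (i j))) \<le> ennreal (2 ^ (d - 1) * (1 + 1 / ln 2) ^ (d - 1)) *
      ennreal (\<Sum>n\<in>?G. \<Delta> (y n) n / (real n / ln (real n + 1) ^ (d - 1)))"
    by (subst ennreal_mult'[symmetric]) (auto intro!: ennreal_leI)
  also have "\<dots> \<le> ennreal (2 ^ (d - 1) * (1 + 1 / ln 2) ^ (d - 1)) *
      Lambda_sharp_V_at (\<lambda>n. real n / ln (real n + 1) ^ (d - 1)) d s f T"
    unfolding \<Delta>_def using F(1) G y(1) I[OF \<alpha>(2)]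
    by (intro mult_left_mono sum_le_Lambda_sharp_V_at) auto
  finally show ?thesis .
qed

section \<open>Summation over directions and over coordinate sets\<close>

lemma HV_alpha_le_Lambda_sharp_V:
  assumes \<alpha>: "\<alpha> \<subseteq> {1..d}" "\<alpha> \<noteq> {}" and "T \<noteq> {}"
  shows "HV_alpha d \<alpha> f T \<le> ennreal (2 ^ (d - 1) * (1 + 1 / ln 2) ^ (d - 1)) *
           Lambda_sharp_V (\<lambda>n. real n / ln (real n + 1) ^ (d - 1)) d f T"
    (is "_ \<le> ?C * Lambda_sharp_V ?\<Lambda> d f T")
proof -
  have fin: "finite \<alpha>" using \<alpha>(1) finite_subset by blast
  have "(\<Sum>i\<in>F. ennreal (\<bar>mixed_diff f (rev (sorted_list_of_set \<alpha>)) (\<lambda>j. I j (i j)) x\<bar>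
                / (\<Prod>j\<in>\<alpha>. real (i j)))) \<le> ?C * Lambda_sharp_V ?\<Lambda> d f T"
    (is "sum ?t F \<le> _")
    if x: "x \<in> {1..d} - \<alpha> \<rightarrow>\<^sub>E T" and I: "\<forall>j\<in>\<alpha>. nonoverlapping T (N j) (I j)"
      and F: "finite F" "F \<subseteq> (\<Pi>\<^sub>E j\<in>\<alpha>. index_set (N j))" for x N I F
  proof -
    have "\<exists>s\<in>\<alpha>. \<forall>j\<in>\<alpha>. i j \<le> i s" for i :: "nat \<Rightarrow> nat"
    proof -
      have "Max (i ` \<alpha>) \<in> i ` \<alpha>" using fin \<alpha>(2) by (intro Max_in) auto
      then obtain s where s: "s \<in> \<alpha>" "Max (i ` \<alpha>) = i s" by blast
      have "i j \<le> i s" if "j \<in> \<alpha>" for j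
        unfolding s(2)[symmetric] using fin that by (intro Max_ge) auto
      then show ?thesis using s(1) by blast
    qed
    \<comment> \<open>\<open>m\<close> picks one position of a largest entry and thereby breaks
      ties, so the sets \<open>?F s\<close> partition \<open>F\<close>.\<close>
    then obtain m where m: "\<And>i::nat \<Rightarrow> nat. m i \<in> \<alpha>" "\<And>i j. j \<in> \<alpha> \<Longrightarrow> i j \<le> i (m i)"
      by metis
    let ?F = "\<lambda>s. {i\<in>F. m i = s}"
    have "sum ?t F = (\<Sum>s\<in>\<alpha>. sum ?t (?F s))"
      using m(1) fin F(1) by (intro sum.group[symmetric]) auto
    also have "\<dots> \<le> (\<Sum>s\<in>\<alpha>. ?C * Lambda_sharp_V_at ?\<Lambda> d s f T)"
    proof (rule sum_mono)
      fix s assume s: "s \<in> \<alpha>"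
      show "sum ?t (?F s) \<le> ?C * Lambda_sharp_V_at ?\<Lambda> d s f T"
      proof (subst sum_ennreal)
        have "?F s \<subseteq> (\<Pi>\<^sub>E j\<in>\<alpha>. index_set (N j))" using F(2) by blast
        moreover have "i j \<le> i s" if "i \<in> ?F s" "j \<in> \<alpha>" for i j
          using that m(2) by auto
        ultimately show "ennreal (\<Sum>i\<in>?F s. \<bar>mixed_diff f (rev (sorted_list_of_set \<alpha>))
            (\<lambda>j. I j (i j)) x\<bar> / (\<Prod>j\<in>\<alpha>. real (i j))) \<le> ?C * Lambda_sharp_V_at ?\<Lambda> d s f T"
          using I F(1) \<open>T \<noteq> {}\<close> by (intro sum_max_index_le_Lambda_sharp_V_at[OF \<alpha>(1) s x]) auto
      qed (simp add: prod_nonneg)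
    qed
    \<comment> \<open>Directions outside \<alpha> only add nonnegative terms.\<close>
    also have "\<dots> \<le> (\<Sum>s = 1..d. ?C * Lambda_sharp_V_at ?\<Lambda> d s f T)"
      using \<alpha>(1) by (intro sum_mono2) auto
    also have "\<dots> = ?C * Lambda_sharp_V ?\<Lambda> d f T"
      by (simp only: Lambda_sharp_V_def sum_distrib_left)
    finally show ?thesis .
  qed
  then show ?thesis
    unfolding HV_alpha_def by (auto intro!: SUP_least infsum_ennreal_leI)
qed

theorem theorem1:
  fixes d :: nat
  assumes "d \<ge> 2"
  shows "\<exists>M::real. M > 0 \<and>
    (\<forall>(t1::real) (t2::real) (f :: (nat \<Rightarrow> real) \<Rightarrow> real). t1 < t2 \<longrightarrow>
       HV d f {t1<..<t2} \<le>
         ennreal M * Lambda_sharp_V (\<lambda>n. real n / ln (real n + 1) ^ (d - 1)) d f {t1<..<t2})"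
proof (intro exI conjI allI impI)
  \<comment> \<open>Each nonempty \<alpha> obeys the same bound with constant \<open>?C\<close>, so
    the final constant is \<open>?C\<close> times the number \<open>?c\<close> of such sets.\<close>
  let ?c = "card (Pow {1..d} - {{}})" and ?C = "2 ^ (d - 1) * (1 + 1 / ln 2) ^ (d - 1) :: real"
  let ?V = "\<lambda>f T. Lambda_sharp_V (\<lambda>n. real n / ln (real n + 1) ^ (d - 1)) d f T"
  have C: "0 < ?C" by (simp add: add_pos_pos)
  have "{1} \<in> Pow {1..d} - {{}}" using assms by auto
  then have "0 < ?c" by (subst card_gt_0_iff) blast
  with C show "0 < real ?c * ?C" by simp
  fix t1 t2 :: real and f :: "(nat \<Rightarrow> real) \<Rightarrow> real"
  assume "t1 < t2"
  then have "HV d f {t1<..<t2} \<le> (\<Sum>\<alpha>\<in>Pow {1..d} - {{}}. ennreal ?C * ?V f {t1<..<t2})"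
    unfolding HV_def by (intro sum_mono HV_alpha_le_Lambda_sharp_V) auto
  also have "\<dots> = ennreal (real ?c * ?C) * ?V f {t1<..<t2}"
    using C by (simp only: sum_constant ennreal_mult' of_nat_0_le_iff ennreal_of_nat_eq_real_of_nat mult.assoc)
  finally show "HV d f {t1<..<t2} \<le> ennreal (real ?c * ?C) * ?V f {t1<..<t2}" .
qed

end
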